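(* Let $k\geq 3$ and let $2\leq n_1\leq n_2\leq \cdots\leq n_k$ be integers. The $n_1\times\cdots\times n_k$ chessboard has \emph{no} closed knight tour if and only if at least one of the following holds: (a) $n_i$ is odd for every $i\in\{1,\dots,k\}$; (b) $n_{k-1}=2$; (c) $n_k=3$.
   Context: The $n_1\times\cdots\times n_k$ chessboard is the set $\mathcal{B}=\{1,\dots,n_1\}\times\cdots\times\{1,\dots,n_k\}\subset\mathbb{Z}^k$. A knight move is a vector $c\in\mathbb{Z}^k$ having exactly one coordinate in $\{\pm1\}$, exactly one coordinate in $\{\pm 2\}$, and all other $k-2$ coordinates equal to $0$. The knight graph on $\mathcal{B}$ has an edge between $a,b\in\mathcal{B}$ iff $a-b$ is a knight move. A closed knight tour is a Hamiltonian cycle in this graph. *)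

theory Defs
  imports Main
begin

definition chessboard :: "nat list \<Rightarrow> int list set" where
  "chessboard ns = {p. length p = length ns \<and>
      (\<forall>i < length ns. 1 \<le> p ! i \<and> p ! i \<le> int (ns ! i))}"

definition knight_move :: "int list \<Rightarrow> bool" where
  "knight_move c \<longleftrightarrow> (\<exists>i < length c. \<exists>j < length c. i \<noteq> j \<and>
      \<bar>c ! i\<bar> = 1 \<and> \<bar>c ! j\<bar> = 2 \<and>
      (\<forall>l < length c. l \<noteq> i \<and> l \<noteq> j \<longrightarrow> c ! l = 0))"

definition knight_adj :: "int list \<Rightarrow> int list \<Rightarrow> bool" where
  "knight_adj a b \<longleftrightarrow> length a = length b \<and> knight_move (map2 (-) a b)"

definition closed_knight_tour :: "nat list \<Rightarrow> int list list \<Rightarrow> bool" where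
  "closed_knight_tour ns vs \<longleftrightarrow> distinct vs \<and> set vs = chessboard ns \<and>
      length vs \<ge> 3 \<and>
      (\<forall>i < length vs. knight_adj (vs ! i) (vs ! ((i + 1) mod length vs)))"

definition has_closed_knight_tour :: "nat list \<Rightarrow> bool" where
  "has_closed_knight_tour ns \<longleftrightarrow> (\<exists>vs. closed_knight_tour ns vs)"

end

theory Submission
  imports Defs "HOL-Combinatorics.Permutations"
begin

text \<open>Two disjoint closed tours merge when an edge \<open>{u, v}\<close> of the first and an edge \<open>{p, q}\<close>
  of the second are replaced by knight moves \<open>{u, p}\<close> and \<open>{v, q}\<close>. Small three-dimensional
  tours that contain prescribed edges near their faces can therefore be glued along every axis, and
  gluing the \<open>2 \<times> a \<times> b\<close> boards with \<open>a \<in> {3, 4, 5}\<close>, \<open>b \<in> {4, 5, 6, 7}\<close> together with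
  \<open>4 \<times> 3 \<times> 3\<close> and \<open>6 \<times> 3 \<times> 3\<close> yields, up to a
  permutation of the axes, every solvable board of dimension three. A further
  dimension is added by stacking copies of one tour, joined at edges that differ by moves of length
  two. Every solvable board contains an even side and two further sides which together already
  form a solvable three-dimensional board, so the general case follows up to a permutation of the axes.

  For the converse, a board of odd volume has no closed tour by the parity colouring; if only one side
  exceeds two, the parity of that coordinate never changes; and if all sides are at most three, the
  cell with all coordinates equal to two is isolated.\<close>

section \<open>Edge sets of Hamiltonian cycles\<close>

fun path_edges :: "'a list \<Rightarrow> 'a set set" where
  "path_edges (x # y # zs) = insert {x, y} (path_edges (y # zs))"
| "path_edges _ = {}"

text \<open>Recording a cycle by its undirected edges hides its starting point and orientation and
  lets later lemmas track prescribed edges. The bound on the length makes the closing edge differ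
  from the edges of the path.\<close>

definition ham_cycle :: "'a set \<Rightarrow> 'a set set \<Rightarrow> bool" where
  "ham_cycle V E \<longleftrightarrow> (\<exists>vs. distinct vs \<and> set vs = V \<and> length vs \<ge> 3 \<and>
     E = insert {last vs, hd vs} (path_edges vs))"

lemma path_edges_append:
  "xs \<noteq> [] \<Longrightarrow> ys \<noteq> [] \<Longrightarrow>
     path_edges (xs @ ys) = insert {last xs, hd ys} (path_edges xs \<union> path_edges ys)"
proof (induction xs rule: path_edges.induct)
  case (1 x y zs)
  then show ?case by (simp add: insert_commute)
next
  case ("2_2" x)
  then show ?case by (cases ys) auto
qed simp

lemma path_edges_rev: "path_edges (rev xs) = path_edges xs"
proof (induction xs)
  case (Cons x xs)
  show ?case
  proof (cases xs)
    case (Cons y ys)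
    then have "path_edges (rev xs @ [x]) = insert {y, x} (path_edges (rev xs))"
      by (subst path_edges_append) (auto simp: last_rev)
    with Cons.IH Cons show ?thesis by (simp add: insert_commute)
  qed simp
qed simp

lemma path_edges_map: "path_edges (map f xs) = (`) f ` path_edges xs"
  by (induction xs rule: path_edges.induct) auto

lemma path_edges_split:
  assumes "e \<in> path_edges xs"
  obtains ys zs where "xs = ys @ zs" "ys \<noteq> []" "zs \<noteq> []" "e = {last ys, hd zs}"
proof -
  have "\<exists>ys zs. xs = ys @ zs \<and> ys \<noteq> [] \<and> zs \<noteq> [] \<and> e = {last ys, hd zs}"
    using assms
  proof (induction xs rule: path_edges.induct)
    case (1 x y zs)
    show ?case
    proof (cases "e = {x, y}")
      case True
      then have "x # y # zs = [x] @ y # zs \<and> e = {last [x], hd (y # zs)}" by simp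
      then show ?thesis by blast
    next
      case False
      with 1 obtain as bs where "y # zs = as @ bs" "as \<noteq> []" "bs \<noteq> []" "e = {last as, hd bs}"
        by auto
      then have "x # y # zs = (x # as) @ bs \<and> bs \<noteq> [] \<and> e = {last (x # as), hd bs}" by simp
      then show ?thesis by blast
    qed
  qed simp_all
  then show thesis using that by blast
qed

lemma path_edges_nth:
  "Suc i < length xs \<Longrightarrow> {xs ! i, xs ! Suc i} \<in> path_edges xs"
proof (induction xs arbitrary: i rule: path_edges.induct)
  case (1 x y zs)
  then show ?case by (cases i) auto
qed auto

text \<open>Rotating the cycle turns any chosen edge into the closing one; reversing the resulting
  path if necessary makes it run from \<open>u\<close> to \<open>v\<close>.\<close>

lemma ham_cycle_cut:
  assumes "ham_cycle V E" and "{u, v} \<in> E"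
  obtains ps where "distinct ps" "set ps = V" "length ps \<ge> 3" "hd ps = u" "last ps = v"
    "E = insert {u, v} (path_edges ps)"
proof -
  obtain vs where vs: "distinct vs" "set vs = V" "length vs \<ge> 3"
    "E = insert {last vs, hd vs} (path_edges vs)"
    using assms(1) unfolding ham_cycle_def by blast
  have "\<exists>ps. distinct ps \<and> set ps = V \<and> length ps \<ge> 3 \<and> {hd ps, last ps} = {u, v} \<and>
    E = insert {u, v} (path_edges ps)"
  proof (cases "{u, v} = {last vs, hd vs}")
    case True
    with vs show ?thesis by (metis insert_commute)
  next
    case False
    with vs assms(2) have "{u, v} \<in> path_edges vs" by auto
    then obtain ys zs where s: "vs = ys @ zs" "ys \<noteq> []" "zs \<noteq> []" "{u, v} = {last ys, hd zs}"
      by (rule path_edges_split)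
    \<comment> \<open>In the rotated list \<open>zs @ ys\<close> the junction is the old closing
      edge, and the old junction \<open>{last ys, hd zs}\<close> closes the cycle.\<close>
    have "E = insert {u, v} (path_edges (zs @ ys))"
      unfolding vs(4) s(1,4) using s(2,3) by (auto simp: path_edges_append)
    moreover have "distinct (zs @ ys)" "set (zs @ ys) = V" "length (zs @ ys) \<ge> 3"
      using vs s(1) by auto
    moreover have "{hd (zs @ ys), last (zs @ ys)} = {u, v}"
      using s by auto
    ultimately show ?thesis by blast
  qed
  then obtain ps where ps: "distinct ps" "set ps = V" "length ps \<ge> 3" "{hd ps, last ps} = {u, v}"
    "E = insert {u, v} (path_edges ps)" by blast
  then have ne: "ps \<noteq> []" by auto
  from ps(4) consider "hd ps = u" "last ps = v" | "hd ps = v" "last ps = u"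
    by (auto simp: doubleton_eq_iff)
  then show thesis
  proof cases
    case 1
    with ps that show thesis by blast
  next
    case 2
    with ps ne that[of "rev ps"] show thesis
      by (simp add: hd_rev last_rev path_edges_rev)
  qed
qed

text \<open>Traversing \<open>ps\<close> from \<open>u\<close> to \<open>v\<close> and then the
  image of \<open>qs\<close> backwards from \<open>f q\<close> to \<open>f p\<close> creates exactly
  the edges \<open>{v, f q}\<close> and \<open>{u, f p}\<close>. The lower bounds on
  \<open>G\<close> keep edges available for further merges; the upper bound serves to show that all
  edges are knight moves.\<close>

lemma ham_cycle_merge:
  assumes "ham_cycle V E" "ham_cycle W F" "inj_on f W" "V \<inter> f ` W = {}"
    and "{u, v} \<in> E" "{p, q} \<in> F"
  obtains G where "ham_cycle (V \<union> f ` W) G"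
    "E - {{u, v}} \<subseteq> G" "(`) f ` (F - {{p, q}}) \<subseteq> G"
    "G \<subseteq> E \<union> (`) f ` F \<union> {{u, f p}, {v, f q}}"
proof -
  obtain ps where ps: "distinct ps" "set ps = V" "length ps \<ge> 3" "hd ps = u" "last ps = v"
    "E = insert {u, v} (path_edges ps)"
    using ham_cycle_cut[OF assms(1,5)] by blast
  obtain qs where qs: "distinct qs" "set qs = W" "length qs \<ge> 3" "hd qs = p" "last qs = q"
    "F = insert {p, q} (path_edges qs)"
    using ham_cycle_cut[OF assms(2,6)] by blast
  define rs where "rs = ps @ rev (map f qs)"
  define G where "G = insert {last rs, hd rs} (path_edges rs)"
  have ne: "ps \<noteq> []" "qs \<noteq> []" using ps(3) qs(3) by auto
  have G: "G = {{u, f p}, {v, f q}} \<union> path_edges ps \<union> (`) f ` path_edges qs"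
    unfolding G_def rs_def using ne ps(4,5) qs(4,5)
    by (auto simp: path_edges_append path_edges_rev path_edges_map last_rev hd_rev hd_map last_map)
  have "distinct rs" "set rs = V \<union> f ` W" "length rs \<ge> 3"
    unfolding rs_def using ps qs assms(3,4) by (auto simp: distinct_map)
  then have "ham_cycle (V \<union> f ` W) G"
    unfolding ham_cycle_def G_def by blast
  then show thesis
    by (rule that) (auto simp: G ps(6) qs(6))
qed

lemma ham_cycle_image:
  assumes "ham_cycle V E" "inj_on f V"
  shows "ham_cycle (f ` V) ((`) f ` E)"
proof -
  obtain vs where vs: "distinct vs" "set vs = V" "length vs \<ge> 3"
    "E = insert {last vs, hd vs} (path_edges vs)"
    using assms(1) unfolding ham_cycle_def by blast
  then have "vs \<noteq> []" by auto
  with vs assms(2) have "distinct (map f vs) \<and> set (map f vs) = f ` V \<and> length (map f vs) \<ge> 3 \<and>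
    (`) f ` E = insert {last (map f vs), hd (map f vs)} (path_edges (map f vs))"
    by (auto simp: distinct_map path_edges_map last_map hd_map)
  then show ?thesis unfolding ham_cycle_def by (rule exI)
qed

section \<open>Knight moves\<close>

text \<open>For positive \<open>m\<close> this is what remains of a knight move once its first
  nonzero coordinate has been read: exactly one coordinate changes, by \<open>m\<close> in absolute
  value. The recursion lets the simplifier evaluate it on explicit cells.\<close>

fun jump :: "int \<Rightarrow> int list \<Rightarrow> int list \<Rightarrow> bool" where
  "jump m (x # a) (y # b) \<longleftrightarrow> (if x = y then jump m a b else \<bar>x - y\<bar> = m \<and> a = b)"
| "jump m _ _ \<longleftrightarrow> False"

text \<open>The recursion reads equal coordinates until the first difference, which has to be the
  only one. For \<open>m = 0\<close> the right-hand side would also accept equal nonempty lists,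
  which \<open>jump\<close> rejects.\<close>

lemma jump_altdef:
  assumes "m \<noteq> 0" "length a = length b"
  shows "jump m a b \<longleftrightarrow> (let c = map2 (-) a b in
    \<exists>i < length c. \<bar>c ! i\<bar> = m \<and> (\<forall>l < length c. l \<noteq> i \<longrightarrow> c ! l = 0))"
  using assms(2)
proof (induction a b rule: list_induct2)
  case (Cons x a y b)
  have "(\<forall>l < length a. map2 (-) a b ! l = 0) \<longleftrightarrow> a = b"
    using Cons.hyps by (auto simp: list_eq_iff_nth_eq)
  with Cons assms(1) show ?case
    by (auto simp: Let_def Ex_less_Suc2 All_less_Suc2)
qed simp

lemma knight_adj_Nil [simp]: "\<not> knight_adj [] b" "\<not> knight_adj a []"
  by (auto simp: knight_adj_def knight_move_def)

text \<open>A nonzero first difference is either the 1 or the 2 of the move, and the tail must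
  supply the other one. As a simp rule this decides adjacency of explicit cells, which the concrete
  tours rely on.\<close>

lemma knight_adj_Cons [simp]:
  "knight_adj (x # a) (y # b) \<longleftrightarrow>
     (if x = y then knight_adj a b
      else \<bar>x - y\<bar> = 1 \<and> jump 2 a b \<or> \<bar>x - y\<bar> = 2 \<and> jump 1 a b)"
proof (cases "length a = length b")
  case True
  define c where "c = map2 (-) a b"
  have c: "knight_move ((x - y) # c) \<longleftrightarrow> (if x = y then knight_move c
      else \<bar>x - y\<bar> = 1 \<and> jump 2 a b \<or> \<bar>x - y\<bar> = 2 \<and> jump 1 a b)"
    using jump_altdef[of 1, OF _ True] jump_altdef[of 2, OF _ True]
    unfolding knight_move_def length_Cons Ex_less_Suc2 All_less_Suc2 c_def[symmetric] Let_def
    by (auto; blast)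
  then show ?thesis using True by (simp add: knight_adj_def c_def)
next
  case False
  have "\<not> jump m a b" for m using False by (induction m a b rule: jump.induct) (auto split: if_splits)
  with False show ?thesis by (simp add: knight_adj_def)
qed

lemma knight_adj_sym: "knight_adj a b \<longleftrightarrow> knight_adj b a"
proof -
  have "map2 (-) b a = map uminus (map2 (-) a b)" if "length a = length b"
    using that by (auto intro: nth_equalityI)
  moreover have "knight_move (map uminus c) \<longleftrightarrow> knight_move c" for c
    by (auto simp: knight_move_def cong: conj_cong)
  ultimately show ?thesis unfolding knight_adj_def by metis
qed

definition knight_edges :: "int list set set" where
  "knight_edges = {{a, b} |a b. knight_adj a b}"

lemma knight_edges_iff [simp]: "{a, b} \<in> knight_edges \<longleftrightarrow> knight_adj a b"
  by (auto simp: knight_edges_def doubleton_eq_iff knight_adj_sym)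

lemma image_knight_edges:
  assumes "\<And>a b. knight_adj a b \<Longrightarrow> knight_adj (f a) (f b)"
  shows "(`) f ` knight_edges \<subseteq> knight_edges"
  using assms by (auto simp: knight_edges_def)

definition knight_cycle :: "nat list \<Rightarrow> int list set set \<Rightarrow> bool" where
  "knight_cycle ns E \<longleftrightarrow> ham_cycle (chessboard ns) E \<and> E \<subseteq> knight_edges"

lemma knight_cycle_imp_tour:
  assumes "knight_cycle ns E"
  shows "has_closed_knight_tour ns"
proof -
  obtain vs where vs: "distinct vs" "set vs = chessboard ns" "length vs \<ge> 3"
    "E = insert {last vs, hd vs} (path_edges vs)" and E: "E \<subseteq> knight_edges"
    using assms unfolding knight_cycle_def ham_cycle_def by blast
  have "knight_adj (vs ! i) (vs ! ((i + 1) mod length vs))" if i: "i < length vs" for i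
  proof (cases "Suc i = length vs")
    case True
    then have "vs ! i = last vs" "vs ! ((i + 1) mod length vs) = hd vs"
      by (metis diff_Suc_1 last_conv_nth length_0_conv nat.distinct(1))
        (metis True Suc_eq_plus1 hd_conv_nth length_0_conv mod_self nat.distinct(1))
    with vs(4) E show ?thesis by simp
  next
    case False
    with i have "Suc i < length vs" by simp
    with path_edges_nth[OF this] vs(4) E show ?thesis
      by (metis Suc_eq_plus1 insertCI knight_edges_iff mod_less subsetD)
  qed
  with vs show ?thesis
    unfolding has_closed_knight_tour_def closed_knight_tour_def by blast
qed

text \<open>Since \<open>f\<close> preserves knight moves, the two connecting edges are the only
  ones whose legality has to be supplied.\<close>

lemma knight_cycle_merge:
  assumes "knight_cycle ns E" "knight_cycle ms F" "inj f"
    and "\<And>a b. knight_adj a b \<Longrightarrow> knight_adj (f a) (f b)"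
    and "chessboard ks = chessboard ns \<union> f ` chessboard ms" "chessboard ns \<inter> f ` chessboard ms = {}"
    and "{u, v} \<in> E" "{p, q} \<in> F" "knight_adj u (f p)" "knight_adj v (f q)"
  obtains G where "knight_cycle ks G" "E - {{u, v}} \<subseteq> G" "(`) f ` F - {f ` {p, q}} \<subseteq> G"
proof -
  have E: "ham_cycle (chessboard ns) E" "E \<subseteq> knight_edges"
    and F: "ham_cycle (chessboard ms) F" "F \<subseteq> knight_edges"
    using assms(1,2) by (auto simp: knight_cycle_def)
  obtain G where G: "ham_cycle (chessboard ks) G" "E - {{u, v}} \<subseteq> G" "(`) f ` (F - {{p, q}}) \<subseteq> G"
    "G \<subseteq> E \<union> (`) f ` F \<union> {{u, f p}, {v, f q}}"
    using ham_cycle_merge[OF E(1) F(1) inj_on_subset[OF assms(3) subset_UNIV] assms(6,7,8)]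
      assms(5) by metis
  have "(`) f ` F \<subseteq> knight_edges"
    using image_knight_edges[of f, OF assms(4)] F(2) by blast
  moreover have "{{u, f p}, {v, f q}} \<subseteq> knight_edges" using assms(9,10) by simp
  ultimately have "G \<subseteq> knight_edges"
    by (intro order_trans[OF G(4)] Un_least E(2))
  moreover have "(`) f ` F - {f ` {p, q}} \<subseteq> G"
    using image_diff_subset[of "(`) f" F "{{p, q}}"] G(3) by simp
  ultimately show thesis using that G(1,2) by (auto simp: knight_cycle_def)
qed

section \<open>Adding a dimension\<close>

lemma chessboard_Nil [simp]: "chessboard [] = {[]}"
  by (auto simp: chessboard_def)

lemma Cons_mem_chessboard [simp]:
  "x # p \<in> chessboard (n # ns) \<longleftrightarrow> 1 \<le> x \<and> x \<le> int n \<and> p \<in> chessboard ns"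
  by (auto simp: chessboard_def All_less_Suc2)

lemma chessboard_Cons: "chessboard (n # ns) = (\<Union>x\<in>{1..int n}. (#) x ` chessboard ns)"
proof (intro equalityI subsetI)
  fix p assume p: "p \<in> chessboard (n # ns)"
  then obtain x q where "p = x # q" by (cases p) (auto simp: chessboard_def)
  with p show "p \<in> (\<Union>x\<in>{1..int n}. (#) x ` chessboard ns)" by auto
qed auto

lemma jump_sym: "jump m a b \<longleftrightarrow> jump m b a"
  by (induction m a b rule: jump.induct) auto

definition stackable :: "nat list \<Rightarrow> bool" where
  "stackable ns \<longleftrightarrow> (\<exists>E u v u' v' p q p' q'. knight_cycle ns E \<and>
     {{u, v}, {u', v'}, {p, q}, {p', q'}} \<subseteq> E \<and>
     distinct [{u, v}, {u', v'}, {p, q}, {p', q'}] \<and>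
     jump 2 u u' \<and> jump 2 v v' \<and> jump 2 p p' \<and> jump 2 q q')"

text \<open>The pair \<open>{u, v}\<close>, \<open>{u', v'}\<close> joins consecutive layers; the pair
  \<open>{p, q}\<close>, \<open>{p', q'}\<close> survives in every layer, so two layers again
  provide two pairs.\<close>

lemma stackable_Cons:
  assumes "stackable ns" "n \<ge> 1"
  shows "stackable (n # ns)"
proof -
  obtain E u v u' v' p q p' q' where E: "knight_cycle ns E"
    and e: "{{u, v}, {u', v'}, {p, q}, {p', q'}} \<subseteq> E"
    and d: "distinct [{u, v}, {u', v'}, {p, q}, {p', q'}]"
    and j: "jump 2 u u'" "jump 2 v v'" "jump 2 p p'" "jump 2 q q'"
    using assms(1) unfolding stackable_def by (elim exE conjE) (rule that)
  have e: "{u, v} \<in> E" "{u', v'} \<in> E" "{p, q} \<in> E" "{p', q'} \<in> E"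
    using e by simp_all
  have d: "{u, v} \<noteq> {u', v'}" "{u, v} \<noteq> {p, q}" "{u, v} \<noteq> {p', q'}"
    "{u', v'} \<noteq> {p, q}" "{u', v'} \<noteq> {p', q'}" "{p, q} \<noteq> {p', q'}"
    using d unfolding distinct.simps list.set by blast+
  have j': "jump 2 u' u" "jump 2 v' v" using j(1,2) jump_sym by blast+
  have img: "(#) x ` {a, b} = {x # a, x # b}" for x :: int and a b by simp
  have neq: "{x # a, x # b} \<noteq> {y # c, y # d}" if "x \<noteq> y \<or> {a, b} \<noteq> {c, d}"
    for x y :: int and a b c d using that by (auto simp: doubleton_eq_iff)
  \<comment> \<open>The edge \<open>{u', v'}\<close> of the top layer stays free for the next
    junction. The edge \<open>{u, v}\<close> of the bottom layer is tracked because for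
    \<open>n = 1\<close> the four required edges all lie in one layer.\<close>
  have layers: "\<exists>G. knight_cycle (n # ns) G \<and> {1 # u, 1 # v} \<in> G \<and> {int n # u', int n # v'} \<in> G \<and>
     (\<forall>x\<in>{1..int n}. {x # p, x # q} \<in> G \<and> {x # p', x # q'} \<in> G)"
    using assms(2)
  proof (induction n rule: dec_induct)
    case base
    have "chessboard (1 # ns) = (#) 1 ` chessboard ns"
      by (simp add: chessboard_Cons)
    moreover have "(`) ((#) 1) ` E \<subseteq> knight_edges"
      using image_knight_edges[of "(#) 1"] E unfolding knight_cycle_def by (simp; blast)
    ultimately have "knight_cycle (1 # ns) ((`) ((#) 1) ` E)"
      using E ham_cycle_image[of "chessboard ns" E "(#) 1"] by (simp add: knight_cycle_def)
    moreover have "{1 # a, 1 # b} \<in> (`) ((#) 1) ` E" if "{a, b} \<in> E" for a b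
      using that by (metis img imageI)
    ultimately show ?case using e by auto
  next
    case (step n)
    then obtain G where G: "knight_cycle (n # ns) G" "{1 # u, 1 # v} \<in> G" "{int n # u', int n # v'} \<in> G"
      "\<And>x. x \<in> {1..int n} \<Longrightarrow> {x # p, x # q} \<in> G \<and> {x # p', x # q'} \<in> G"
      by blast
    let ?f = "(#) (int (Suc n))"
    have *: "chessboard (Suc n # ns) = chessboard (n # ns) \<union> ?f ` chessboard ns"
    proof -
      have "{1..int (Suc n)} = insert (int (Suc n)) {1..int n}" by auto
      then show ?thesis by (auto simp: chessboard_Cons)
    qed
    have **: "chessboard (n # ns) \<inter> ?f ` chessboard ns = {}"
      by (auto simp: chessboard_Cons)
    \<comment> \<open>The old top layer is opened at \<open>{u', v'}\<close> and the new layer at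
      \<open>{u, v}\<close>; the connecting moves change the first coordinate by one and another
      coordinate by two.\<close>
    obtain H where H: "knight_cycle (Suc n # ns) H" "G - {{int n # u', int n # v'}} \<subseteq> H"
      "(`) ?f ` E - {?f ` {u, v}} \<subseteq> H"
      by (rule knight_cycle_merge[OF G(1) E _ _ * ** G(3) e(1)])
        (use j' in \<open>simp_all\<close>)
    have new: "{int (Suc n) # a, int (Suc n) # b} \<in> H" if "{a, b} \<in> E" "{u, v} \<noteq> {a, b}" for a b
    proof -
      have "?f ` {a, b} \<in> (`) ?f ` E" using that(1) by blast
      moreover have "?f ` {a, b} \<noteq> ?f ` {u, v}" using that(2) unfolding img by (metis neq)
      ultimately have "?f ` {a, b} \<in> H" by (intro subsetD[OF H(3)] DiffI) simp_all
      then show ?thesis by simp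
    qed
    have old: "{x # a, x # b} \<in> H" if "{x # a, x # b} \<in> G" "{u', v'} \<noteq> {a, b}" for x a b
    proof -
      have "{x # a, x # b} \<noteq> {int n # u', int n # v'}" using that(2) by (metis neq)
      with that(1) show ?thesis by (intro subsetD[OF H(2)] DiffI) simp_all
    qed
    have "{x # p, x # q} \<in> H \<and> {x # p', x # q'} \<in> H" if "x \<in> {1..int (Suc n)}" for x
    proof (cases "x = int (Suc n)")
      case True
      then show ?thesis using new[OF e(3) d(2)] new[OF e(4) d(3)] by simp
    next
      case False
      with that have "x \<in> {1..int n}" by auto
      then have "{x # p, x # q} \<in> G" "{x # p', x # q'} \<in> G" using G(4) by simp_all
      then show ?thesis using old d(4,5) by simp
    qed
    moreover have "{1 # u, 1 # v} \<in> H" by (rule old[OF G(2) d(1)[symmetric]])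
    moreover have "{int (Suc n) # u', int (Suc n) # v'} \<in> H" by (rule new[OF e(2) d(1)])
    ultimately show ?case using H(1) by (intro exI[of _ H] conjI ballI) simp_all
  qed
  then obtain G where G: "knight_cycle (n # ns) G" "{1 # u, 1 # v} \<in> G" "{int n # u', int n # v'} \<in> G"
      "\<And>x. x \<in> {1..int n} \<Longrightarrow> {x # p, x # q} \<in> G \<and> {x # p', x # q'} \<in> G"
    by blast
  show ?thesis
  proof (cases "n = 1")
    case True
    have "{{1 # u, 1 # v}, {1 # u', 1 # v'}, {1 # p, 1 # q}, {1 # p', 1 # q'}} \<subseteq> G"
      using G(2,3) G(4)[of 1] True by simp
    moreover have "distinct [{1 # u, 1 # v}, {1 # u', 1 # v'}, {1 # p, 1 # q}, {1 # p', 1 # q'}]"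
      using d by (simp add: neq)
    moreover have "jump 2 (1 # u) (1 # u')" "jump 2 (1 # v) (1 # v')"
      "jump 2 (1 # p) (1 # p')" "jump 2 (1 # q) (1 # q')" using j by simp_all
    ultimately show ?thesis using G(1) unfolding stackable_def by (intro exI conjI)
  next
    case False
    with assms(2) have n: "int n \<ge> 2" by simp
    \<comment> \<open>Layers 1 and 2 each contribute a copy of the pair \<open>{p, q}\<close>,
      \<open>{p', q'}\<close>.\<close>
    have "{{1 # p, 1 # q}, {1 # p', 1 # q'}, {2 # p, 2 # q}, {2 # p', 2 # q'}} \<subseteq> G"
      using G(4)[of 1] G(4)[of 2] n by simp
    moreover have "distinct [{1 # p, 1 # q}, {1 # p', 1 # q'}, {2 # p, 2 # q}, {2 # p', 2 # q'}]"
      using d by (simp add: neq)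
    moreover have "jump 2 (1 # p) (1 # p')" "jump 2 (1 # q) (1 # q')" 
      "jump 2 (2 # p) (2 # p')" "jump 2 (2 # q) (2 # q')" using j by simp_all
    ultimately show ?thesis using G(1) unfolding stackable_def by (intro exI conjI)
  qed
qed

section \<open>Gluing boards along an existing dimension\<close>

definition shift :: "nat \<Rightarrow> int \<Rightarrow> int list \<Rightarrow> int list" where
  "shift d m p = p[d := p ! d + m]"

lemma length_shift [simp]: "length (shift d m p) = length p"
  by (simp add: shift_def)

lemma nth_shift: "i < length p \<Longrightarrow> shift d m p ! i = (if i = d then p ! i + m else p ! i)"
  by (simp add: shift_def nth_list_update)

lemma shift_simps [simp]:
  "shift 0 m (x # p) = (x + m) # p" "shift (Suc d) m (x # p) = x # shift d m p"
  by (simp_all add: shift_def)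

lemma inj_shift: "inj (shift d m)"
proof (rule injI)
  fix p q assume eq: "shift d m p = shift d m q"
  then have len: "length p = length q" by (metis length_shift)
  show "p = q"
  proof (rule nth_equalityI[OF len])
    fix i assume "i < length p"
    with eq len show "p ! i = q ! i" using nth_shift[of i p d m] nth_shift[of i q d m]
      by (simp split: if_splits)
  qed
qed

lemma knight_adj_shift:
  assumes "knight_adj a b"
  shows "knight_adj (shift d m a) (shift d m b)"
proof -
  have "length a = length b" using assms by (simp add: knight_adj_def)
  then have "map2 (-) (shift d m a) (shift d m b) = map2 (-) a b"
    by (intro nth_equalityI) (auto simp: nth_shift)
  with assms show ?thesis by (simp add: knight_adj_def)
qed

lemma mem_chessboard_update:
  assumes "d < length ns"
  shows "p \<in> chessboard (ns[d := m]) \<longleftrightarrow> length p = length ns \<and> 1 \<le> p ! d \<and> p ! d \<le> int m \<and>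
    (\<forall>i < length ns. i \<noteq> d \<longrightarrow> 1 \<le> p ! i \<and> p ! i \<le> int (ns ! i))"
  unfolding chessboard_def using assms
  by (simp add: nth_list_update) metis

text \<open>Cells are split by whether coordinate \<open>d\<close> exceeds \<open>m\<close>. Writing
  boards as \<open>ns[d := m]\<close> gives boards that agree off axis \<open>d\<close> a common
  form.\<close>

lemma chessboard_glue:
  assumes "d < length ns"
  shows "chessboard (ns[d := m + m']) =
      chessboard (ns[d := m]) \<union> shift d (int m) ` chessboard (ns[d := m'])"
    and "chessboard (ns[d := m]) \<inter> shift d (int m) ` chessboard (ns[d := m']) = {}"
proof -
  note mem = mem_chessboard_update[OF assms]
  show "chessboard (ns[d := m + m']) =
      chessboard (ns[d := m]) \<union> shift d (int m) ` chessboard (ns[d := m'])"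
  proof (intro equalityI subsetI)
    fix p assume p: "p \<in> chessboard (ns[d := m + m'])"
    show "p \<in> chessboard (ns[d := m]) \<union> shift d (int m) ` chessboard (ns[d := m'])"
    proof (cases "p ! d \<le> int m")
      case True
      with p show ?thesis by (simp add: mem)
    next
      case False
      have "shift d (- int m) p \<in> chessboard (ns[d := m'])"
        using p False assms by (simp add: mem nth_shift)
      moreover have "p = shift d (int m) (shift d (- int m) p)"
        by (rule nth_equalityI) (simp_all add: nth_shift)
      ultimately show ?thesis by blast
    qed
  next
    fix p assume "p \<in> chessboard (ns[d := m]) \<union> shift d (int m) ` chessboard (ns[d := m'])"
    then show "p \<in> chessboard (ns[d := m + m'])"
      using assms by (auto simp: mem nth_shift)
  qed
  have "p ! d \<le> int m" if "p \<in> chessboard (ns[d := m])" for p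
    using that by (simp add: mem)
  moreover have "shift d (int m) p ! d > int m" if "p \<in> chessboard (ns[d := m'])" for p
    using that assms by (simp add: mem nth_shift)
  ultimately show "chessboard (ns[d := m]) \<inter> shift d (int m) ` chessboard (ns[d := m']) = {}"
    by fastforce
qed

text \<open>The merge is specialised to a translation along axis \<open>d\<close>. Surviving edges
  are described pairwise, so that they can be looked up for explicit endpoints.\<close>

lemma knight_cycle_glue:
  assumes "knight_cycle (ns[d := m]) E" "knight_cycle (ns[d := m']) F" "d < length ns"
    and "{u, v} \<in> E" "{p, q} \<in> F"
    and "knight_adj u (shift d (int m) p)" "knight_adj v (shift d (int m) q)"
  obtains G where "knight_cycle (ns[d := m + m']) G"
    "\<And>a b. {a, b} \<in> E \<Longrightarrow> {a, b} \<noteq> {u, v} \<Longrightarrow> {a, b} \<in> G"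
    "\<And>a b. {a, b} \<in> F \<Longrightarrow> {a, b} \<noteq> {p, q} \<Longrightarrow> {shift d (int m) a, shift d (int m) b} \<in> G"
proof -
  obtain G where G: "knight_cycle (ns[d := m + m']) G" "E - {{u, v}} \<subseteq> G"
    "(`) (shift d (int m)) ` F - {shift d (int m) ` {p, q}} \<subseteq> G"
    by (rule knight_cycle_merge[OF assms(1,2) inj_shift knight_adj_shift
          chessboard_glue[OF assms(3)] assms(4-7)])
  show thesis
  proof (rule that[OF G(1)])
    fix a b assume "{a, b} \<in> E" "{a, b} \<noteq> {u, v}"
    then show "{a, b} \<in> G" by (intro subsetD[OF G(2)] DiffI) simp_all
  next
    fix a b assume "{a, b} \<in> F" "{a, b} \<noteq> {p, q}"
    moreover from this(2) have "shift d (int m) ` {a, b} \<noteq> shift d (int m) ` {p, q}"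
      by (metis inj_image_eq_iff inj_shift)
    ultimately have "shift d (int m) ` {a, b} \<in> G"
      by (intro subsetD[OF G(3)] DiffI imageI) simp_all
    then show "{shift d (int m) a, shift d (int m) b} \<in> G" by simp
  qed
qed

section \<open>Three dimensions\<close>

text \<open>Along axis 0, \<open>{[k, 1, 3], [k, 2, 1]}\<close> of one board is joined to
  \<open>{[1, 1, 1], [1, 2, 3]}\<close> of the next one; the second and third line give the analogous pairs
  for axes 1 and 2, with the edge at the low face listed first. The edge
  \<open>{[1, 1, 3], [1, 2, 1]}\<close> is only needed for adding a fourth dimension.\<close>

definition port_edges :: "nat \<Rightarrow> nat \<Rightarrow> nat \<Rightarrow> int list set set" where
  "port_edges k a b =
    {{[1, 1, 1], [1, 2, 3]}, {[int k, 1, 3], [int k, 2, 1]}, {[1, 1, 3], [1, 2, 1]},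
     {[1, 1, 3], [2, 1, 1]}, {[1, int a, 1], [2, int a, 3]},
     {[1, 1, 1], [2, 3, 1]}, {[1, 3, int b], [2, 1, int b]}}"

definition ported :: "nat \<Rightarrow> nat \<Rightarrow> nat \<Rightarrow> bool" where
  "ported k a b \<longleftrightarrow> (\<exists>E. knight_cycle [k, a, b] E \<and> port_edges k a b \<subseteq> E)"

text \<open>The glued tour inherits its high-face edge on axis 0 from the translated second board
  and all other port edges from the first. For \<open>m = 1\<close> the removed edge
  \<open>{[int m, 1, 3], [int m, 2, 1]}\<close> would coincide with the port edge
  \<open>{[1, 1, 3], [1, 2, 1]}\<close>, hence \<open>m \<ge> 2\<close>.\<close>

lemma ported_glue_0:
  assumes "ported m a b" "ported m' a b" "m \<ge> 2"
  shows "ported (m + m') a b"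
proof -
  \<comment> \<open>The entry 0 in \<open>[0, a, b]\<close> is a placeholder that the update
    overwrites, so that both boards have the form required by
    \<open>knight_cycle_glue\<close>.\<close>
  obtain E F where E: "knight_cycle ([0, a, b][0 := m]) E" "port_edges m a b \<subseteq> E"
    and F: "knight_cycle ([0, a, b][0 := m']) F" "port_edges m' a b \<subseteq> F"
    using assms(1,2) by (auto simp: ported_def)
  note e = E(2)[unfolded port_edges_def, simplified] F(2)[unfolded port_edges_def, simplified]
  obtain G where G: "knight_cycle ([0, a, b][0 := m + m']) G"
    "\<And>x y. {x, y} \<in> E \<Longrightarrow> {x, y} \<noteq> {[int m, 1, 3], [int m, 2, 1]} \<Longrightarrow> {x, y} \<in> G"
    "\<And>x y. {x, y} \<in> F \<Longrightarrow> {x, y} \<noteq> {[1, 1, 1], [1, 2, 3]} \<Longrightarrow>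
      {shift 0 (int m) x, shift 0 (int m) y} \<in> G"
    by (rule knight_cycle_glue[OF E(1) F(1), of "[int m, 1, 3]" "[int m, 2, 1]" "[1, 1, 1]" "[1, 2, 3]"])
      (use e in \<open>simp_all\<close>)
  have "{shift 0 (int m) [int m', 1, 3], shift 0 (int m) [int m', 2, 1]} \<in> G"
    by (rule G(3)) (use e in \<open>simp_all add: doubleton_eq_iff\<close>)
  then have "{[int (m + m'), 1, 3], [int (m + m'), 2, 1]} \<in> G" by (simp add: add.commute)
  with e assms(3) have "port_edges (m + m') a b \<subseteq> G"
    by (simp add: port_edges_def doubleton_eq_iff G(2))
  with G(1) show ?thesis by (auto simp: ported_def)
qed

text \<open>The connecting moves change coordinate 1 by one and coordinate 2 by two; the high-face
  edge on axis 1 comes from the second board.\<close>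

lemma ported_glue_1:
  assumes "ported k m b" "ported k m' b"
  shows "ported k (m + m') b"
proof -
  obtain E F where E: "knight_cycle ([k, 0, b][Suc 0 := m]) E" "port_edges k m b \<subseteq> E"
    and F: "knight_cycle ([k, 0, b][Suc 0 := m']) F" "port_edges k m' b \<subseteq> F"
    using assms(1,2) by (auto simp: ported_def)
  note e = E(2)[unfolded port_edges_def, simplified] F(2)[unfolded port_edges_def, simplified]
  obtain G where G: "knight_cycle ([k, 0, b][Suc 0 := m + m']) G"
    "\<And>x y. {x, y} \<in> E \<Longrightarrow> {x, y} \<noteq> {[1, int m, 1], [2, int m, 3]} \<Longrightarrow> {x, y} \<in> G"
    "\<And>x y. {x, y} \<in> F \<Longrightarrow> {x, y} \<noteq> {[1, 1, 3], [2, 1, 1]} \<Longrightarrow>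
      {shift (Suc 0) (int m) x, shift (Suc 0) (int m) y} \<in> G"
    by (rule knight_cycle_glue[OF E(1) F(1), of "[1, int m, 1]" "[2, int m, 3]" "[1, 1, 3]" "[2, 1, 1]"])
      (use e in \<open>simp_all\<close>)
  have "{shift (Suc 0) (int m) [1, int m', 1], shift (Suc 0) (int m) [2, int m', 3]} \<in> G"
    by (rule G(3)) (use e in \<open>simp_all add: doubleton_eq_iff\<close>)
  then have "{[1, int (m + m'), 1], [2, int (m + m'), 3]} \<in> G" by (simp add: add.commute)
  with e have "port_edges k (m + m') b \<subseteq> G"
    by (simp add: port_edges_def doubleton_eq_iff G(2))
  with G(1) show ?thesis by (auto simp: ported_def)
qed

text \<open>The connecting moves change coordinate 2 by one and coordinate 1 by two; the high-face
  edge on axis 2 comes from the second board.\<close>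

lemma ported_glue_2:
  assumes "ported k a m" "ported k a m'"
  shows "ported k a (m + m')"
proof -
  obtain E F where E: "knight_cycle ([k, a, 0][Suc (Suc 0) := m]) E" "port_edges k a m \<subseteq> E"
    and F: "knight_cycle ([k, a, 0][Suc (Suc 0) := m']) F" "port_edges k a m' \<subseteq> F"
    using assms(1,2) by (auto simp: ported_def)
  note e = E(2)[unfolded port_edges_def, simplified] F(2)[unfolded port_edges_def, simplified]
  obtain G where G: "knight_cycle ([k, a, 0][Suc (Suc 0) := m + m']) G"
    "\<And>x y. {x, y} \<in> E \<Longrightarrow> {x, y} \<noteq> {[1, 3, int m], [2, 1, int m]} \<Longrightarrow> {x, y} \<in> G"
    "\<And>x y. {x, y} \<in> F \<Longrightarrow> {x, y} \<noteq> {[1, 1, 1], [2, 3, 1]} \<Longrightarrow>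
      {shift (Suc (Suc 0)) (int m) x, shift (Suc (Suc 0)) (int m) y} \<in> G"
    by (rule knight_cycle_glue[OF E(1) F(1), of "[1, 3, int m]" "[2, 1, int m]" "[1, 1, 1]" "[2, 3, 1]"])
      (use e in \<open>simp_all\<close>)
  have "{shift (Suc (Suc 0)) (int m) [1, 3, int m'], shift (Suc (Suc 0)) (int m) [2, 1, int m']} \<in> G"
    by (rule G(3)) (use e in \<open>simp_all add: doubleton_eq_iff\<close>)
  then have "{[1, 3, int (m + m')], [2, 1, int (m + m')]} \<in> G" by (simp add: add.commute)
  with e have "port_edges k a (m + m') \<subseteq> G"
    by (simp add: port_edges_def doubleton_eq_iff G(2))
  with G(1) show ?thesis by (auto simp: ported_def)
qed

text \<open>Four port edges near one corner already form two pairs: each pair contains an edge at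
  \<open>[1, 1, 1]\<close> and one at \<open>[1, 1, 3]\<close>, and their other ends also differ by
  two in one coordinate.\<close>

lemma ported_imp_stackable:
  assumes "ported k a b"
  shows "stackable [k, a, b]"
proof -
  obtain E where E: "knight_cycle [k, a, b] E" "port_edges k a b \<subseteq> E"
    using assms by (auto simp: ported_def)
  have "{{[1, 1, 1], [2, 3, 1]}, {[1, 1, 3], [2, 1, 1]}, {[1, 1, 1], [1, 2, 3]}, {[1, 1, 3], [1, 2, 1]}} \<subseteq> E"
    using E(2) by (auto simp: port_edges_def)
  moreover have "distinct [{[1, 1, 1 :: int], [2, 3, 1]}, {[1, 1, 3], [2, 1, 1]},
      {[1, 1, 1], [1, 2, 3]}, {[1, 1, 3], [1, 2, 1]}]"
    by (simp add: doubleton_eq_iff)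
  moreover have "jump 2 [1, 1, 1] [1, 1, 3]" "jump 2 [2, 3, 1] [2, 1, 1]" "jump 2 [1, 2, 3] [1, 2, 1]"
    by simp_all
  ultimately show ?thesis using E(1) unfolding stackable_def by (intro exI conjI)
qed

section \<open>Verification of explicit three-dimensional tours\<close>

lemma finite_card_chessboard: "finite (chessboard ns) \<and> card (chessboard ns) = prod_list ns"
proof (induction ns)
  case (Cons n ns)
  have "chessboard (n # ns) = (\<lambda>(x, p). x # p) ` ({1..int n} \<times> chessboard ns)"
    by (auto simp: chessboard_Cons)
  moreover have "inj_on (\<lambda>(x, p). x # p) ({1..int n} \<times> chessboard ns)"
    by (auto simp: inj_on_def)
  ultimately show ?case using Cons.IH by (simp add: card_image)
qed simp

lemma ham_cycle_list:
  assumes "distinct vs" "length vs \<ge> 3"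
  shows "ham_cycle (set vs) (path_edges (vs @ [hd vs]))"
proof -
  have "vs \<noteq> []" using assms(2) by auto
  then have "path_edges (vs @ [hd vs]) = insert {last vs, hd vs} (path_edges vs)"
    by (simp add: path_edges_append)
  with assms show ?thesis unfolding ham_cycle_def by blast
qed

lemma path_edges_knight:
  "successively knight_adj vs \<Longrightarrow> path_edges vs \<subseteq> knight_edges"
  by (induction vs rule: path_edges.induct) simp_all

text \<open>Counting replaces the proof that every cell is visited: a repetition-free list of cells
  of the board whose length is the volume covers it. All premises can then be discharged by
  simplification for an explicit list.\<close>

lemma portedI:
  assumes "distinct vs" "length vs = k * a * b" "length vs \<ge> 3"
    and "\<forall>p\<in>set vs. p \<in> chessboard [k, a, b]"
    and "successively knight_adj (vs @ [hd vs])"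
    and "port_edges k a b \<subseteq> path_edges (vs @ [hd vs])"
  shows "ported k a b"
proof -
  have "set vs = chessboard [k, a, b]"
  proof (rule card_subset_eq)
    show "card (set vs) = card (chessboard [k, a, b])"
      using assms(1,2) by (simp add: distinct_card finite_card_chessboard)
  qed (use assms(4) finite_card_chessboard in auto)
  with assms ham_cycle_list[of vs] path_edges_knight[of "vs @ [hd vs]"] show ?thesis
    unfolding ported_def knight_cycle_def by metis
qed

text \<open>These tours were found with a SAT solver.\<close>

lemma ported_2_3_4: "ported 2 3 4"
  by (rule portedI[of
   "[[1,1,1], [1,2,3], [1,3,1], [2,3,3], [2,2,1], [2,1,3], [2,3,4], [1,1,4], [2,1,2], [1,3,2],
    [1,2,4], [2,2,2], [2,1,4], [1,3,4], [1,2,2], [2,2,4], [2,3,2], [1,1,2], [1,3,3], [1,2,1],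
    [1,1,3], [2,1,1], [2,2,3], [2,3,1]]"])
   (simp_all add: port_edges_def doubleton_eq_iff)

lemma ported_2_3_5: "ported 2 3 5"
  by (rule portedI[of
   "[[1,1,1], [1,2,3], [2,2,5], [2,1,3], [2,2,1], [2,3,3], [1,3,1], [1,1,2], [2,3,2], [2,1,1],
    [1,1,3], [1,2,1], [1,3,3], [1,2,5], [2,2,3], [2,1,5], [1,3,5], [1,1,4], [2,3,4], [1,3,2],
    [1,2,4], [2,2,2], [2,1,4], [2,3,5], [1,1,5], [1,3,4], [1,2,2], [2,2,4], [2,1,2], [2,3,1]]"])
   (simp_all add: port_edges_def doubleton_eq_iff)

lemma ported_2_3_6: "ported 2 3 6"
  by (rule portedI[of
   "[[1,1,1], [1,2,3], [2,2,5], [2,1,3], [2,2,1], [2,3,3], [1,3,1], [1,1,2], [2,3,2], [2,1,1],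
    [1,1,3], [1,2,1], [2,2,3], [1,2,5], [1,3,3], [2,3,5], [1,1,5], [1,3,6], [2,1,6], [2,2,4],
    [1,2,2], [1,1,4], [1,2,6], [1,3,4], [2,3,6], [1,1,6], [1,3,5], [2,1,5], [2,3,4], [2,2,2],
    [2,1,4], [2,2,6], [1,2,4], [1,3,2], [2,1,2], [2,3,1]]"])
   (simp_all add: port_edges_def doubleton_eq_iff)

lemma ported_2_3_7: "ported 2 3 7"
  by (rule portedI[of
   "[[1,1,1], [1,2,3], [1,3,5], [1,1,6], [2,3,6], [2,1,7], [1,3,7], [1,2,5], [2,2,7], [2,1,5],
    [1,1,7], [1,3,6], [1,2,4], [2,2,6], [2,1,4], [2,2,2], [2,3,4], [1,3,2], [2,1,2], [1,1,4],
    [1,2,2], [1,3,4], [1,2,6], [2,2,4], [2,3,2], [1,1,2], [1,3,3], [1,2,1], [1,1,3], [2,1,1],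
    [1,3,1], [2,3,3], [2,2,1], [2,1,3], [1,1,5], [1,2,7], [2,2,5], [2,3,7], [2,1,6], [2,3,5],
    [2,2,3], [2,3,1]]"])
   (simp_all add: port_edges_def doubleton_eq_iff)

lemma ported_2_4_4: "ported 2 4 4"
  by (rule portedI[of
   "[[1,1,1], [1,2,3], [1,4,4], [1,3,2], [1,2,4], [2,4,4], [1,4,2], [1,3,4], [2,1,4], [2,3,3],
    [2,1,2], [2,2,4], [1,2,2], [2,4,2], [2,2,1], [2,1,3], [2,3,2], [1,1,2], [1,3,1], [2,1,1],
    [1,1,3], [1,2,1], [2,2,3], [1,4,3], [2,4,1], [2,2,2], [2,3,4], [1,1,4], [1,3,3], [1,4,1],
    [2,4,3], [2,3,1]]"])
   (simp_all add: port_edges_def doubleton_eq_iff)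

lemma ported_2_4_5: "ported 2 4 5"
  by (rule portedI[of
   "[[1,1,1], [1,2,3], [2,2,5], [1,4,5], [1,2,4], [2,4,4], [1,4,2], [1,3,4], [1,1,5], [2,3,5],
    [2,1,4], [2,2,2], [2,3,4], [1,3,2], [1,4,4], [2,4,2], [1,2,2], [2,2,4], [2,1,2], [2,3,3],
    [1,3,1], [2,1,1], [1,1,3], [1,2,1], [2,4,1], [1,4,3], [2,4,5], [1,2,5], [2,2,3], [2,1,5],
    [1,3,5], [1,1,4], [1,3,3], [1,1,2], [2,3,2], [2,1,3], [2,2,1], [1,4,1], [2,4,3], [2,3,1]]"])
   (simp_all add: port_edges_def doubleton_eq_iff)

lemma ported_2_4_6: "ported 2 4 6"
  by (rule portedI[of
   "[[1,1,1], [1,2,3], [2,2,1], [2,1,3], [2,2,5], [1,4,5], [1,2,4], [2,2,6], [1,4,6], [2,4,4],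
    [1,4,2], [2,2,2], [2,1,4], [1,1,6], [2,3,6], [1,3,4], [2,3,2], [1,1,2], [1,3,1], [2,3,3],
    [1,3,5], [2,1,5], [2,2,3], [2,1,1], [1,1,3], [1,2,1], [2,4,1], [1,4,3], [2,4,5], [1,2,5],
    [1,3,3], [2,3,5], [1,1,5], [1,3,6], [2,1,6], [1,1,4], [2,3,4], [1,3,2], [2,1,2], [2,2,4],
    [1,2,6], [2,4,6], [1,4,4], [2,4,2], [1,2,2], [1,4,1], [2,4,3], [2,3,1]]"])
   (simp_all add: port_edges_def doubleton_eq_iff)

lemma ported_2_4_7: "ported 2 4 7"
  by (rule portedI[of
   "[[1,1,1], [1,2,3], [2,2,5], [1,2,7], [2,4,7], [1,4,5], [1,2,6], [2,4,6], [1,4,4], [2,4,2],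
    [1,2,2], [2,2,4], [2,1,2], [2,3,3], [1,3,1], [2,1,1], [1,1,3], [1,2,1], [2,4,1], [1,4,3],
    [2,4,5], [1,4,7], [2,2,7], [1,2,5], [2,2,3], [2,1,5], [1,3,5], [2,3,7], [1,1,7], [1,3,6],
    [2,1,6], [1,1,4], [2,3,4], [1,3,2], [1,2,4], [2,2,6], [1,4,6], [2,4,4], [1,4,2], [2,2,2],
    [2,1,4], [1,1,6], [2,3,6], [1,3,4], [1,1,5], [2,1,7], [1,3,7], [2,3,5], [1,3,3], [1,1,2],
    [2,3,2], [2,1,3], [2,2,1], [1,4,1], [2,4,3], [2,3,1]]"])
   (simp_all add: port_edges_def doubleton_eq_iff)

lemma ported_2_5_4: "ported 2 5 4"
  by (rule portedI[of
   "[[1,1,1], [1,2,3], [1,4,2], [2,4,4], [1,2,4], [1,3,2], [2,5,2], [1,5,4], [1,3,3], [2,5,3],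
    [1,5,1], [1,4,3], [2,2,3], [2,1,1], [1,1,3], [1,2,1], [2,4,1], [2,2,2], [2,4,3], [1,4,1],
    [1,5,3], [2,5,1], [1,3,1], [1,1,2], [2,3,2], [1,5,2], [2,5,4], [1,3,4], [2,1,4], [2,3,3],
    [2,2,1], [2,1,3], [2,3,4], [1,1,4], [1,2,2], [2,4,2], [1,4,4], [2,2,4], [2,1,2], [2,3,1]]"])
   (simp_all add: port_edges_def doubleton_eq_iff)

lemma ported_2_5_5: "ported 2 5 5"
  by (rule portedI[of
   "[[1,1,1], [1,2,3], [2,4,3], [1,4,1], [2,2,1], [2,1,3], [2,2,5], [1,4,5], [1,3,3], [1,1,4],
    [2,3,4], [1,3,2], [2,5,2], [1,5,4], [1,4,2], [2,4,4], [1,2,4], [2,2,2], [2,1,4], [1,1,2],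
    [2,3,2], [2,1,1], [1,1,3], [1,2,1], [2,4,1], [1,4,3], [2,4,5], [1,2,5], [2,2,3], [2,1,5],
    [1,3,5], [2,5,5], [1,5,3], [2,5,1], [1,3,1], [2,3,3], [2,1,2], [2,2,4], [1,2,2], [2,4,2],
    [1,4,4], [1,5,2], [2,5,4], [1,3,4], [1,1,5], [2,3,5], [1,5,5], [2,5,3], [1,5,1], [2,3,1]]"])
   (simp_all add: port_edges_def doubleton_eq_iff)

lemma ported_2_5_6: "ported 2 5 6"
  by (rule portedI[of
   "[[1,1,1], [1,2,3], [2,2,5], [1,4,5], [2,4,3], [1,4,1], [2,2,1], [2,1,3], [2,3,4], [1,3,2],
    [2,5,2], [1,5,4], [2,5,6], [1,3,6], [2,1,6], [1,1,4], [1,3,3], [1,1,2], [2,1,4], [2,2,2],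
    [1,4,2], [2,4,4], [1,4,6], [2,2,6], [1,2,4], [1,1,6], [2,3,6], [1,5,6], [2,5,4], [1,5,2],
    [2,3,2], [2,1,1], [1,1,3], [1,2,1], [2,4,1], [1,4,3], [2,4,5], [1,2,5], [2,2,3], [2,1,5],
    [1,3,5], [2,5,5], [1,5,3], [2,5,1], [1,3,1], [2,3,3], [2,1,2], [2,2,4], [1,2,6], [2,4,6],
    [1,4,4], [2,4,2], [1,2,2], [1,3,4], [1,1,5], [2,3,5], [1,5,5], [2,5,3], [1,5,1], [2,3,1]]"])
   (simp_all add: port_edges_def doubleton_eq_iff)

lemma ported_2_5_7: "ported 2 5 7"
  by (rule portedI[of
   "[[1,1,1], [1,2,3], [2,2,5], [1,2,7], [2,4,7], [1,4,5], [2,4,3], [1,4,1], [2,2,1], [2,1,3],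
    [2,3,4], [1,1,4], [2,1,6], [1,3,6], [2,5,6], [1,5,4], [2,5,2], [1,3,2], [1,2,4], [2,2,2],
    [1,4,2], [2,4,4], [1,4,6], [2,2,6], [2,1,4], [1,1,6], [2,3,6], [1,5,6], [1,3,5], [2,5,5],
    [1,5,7], [2,3,7], [1,1,7], [2,1,5], [2,2,3], [1,2,5], [2,2,7], [1,4,7], [2,4,5], [1,4,3],
    [2,4,1], [1,2,1], [1,1,3], [2,1,1], [2,3,2], [1,1,2], [1,3,1], [2,5,1], [1,5,3], [2,3,3],
    [2,1,2], [2,2,4], [1,2,2], [2,4,2], [1,4,4], [2,4,6], [1,2,6], [1,3,4], [2,5,4], [1,5,2],
    [1,3,3], [2,3,5], [1,1,5], [2,1,7], [1,3,7], [2,5,7], [1,5,5], [2,5,3], [1,5,1], [2,3,1]]"])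
   (simp_all add: port_edges_def doubleton_eq_iff)

lemma ported_4_3_3: "ported 4 3 3"
  by (rule portedI[of
   "[[1,1,1], [1,2,3], [3,2,2], [1,1,2], [3,1,3], [3,2,1], [1,2,2], [3,2,3], [1,3,3], [2,1,3],
    [4,1,2], [2,2,2], [4,2,3], [2,3,3], [1,3,1], [3,3,2], [2,1,2], [4,1,1], [2,2,1], [4,2,2],
    [2,2,3], [4,3,3], [2,3,2], [4,3,1], [3,1,1], [4,1,3], [4,2,1], [2,1,1], [1,1,3], [1,2,1],
    [3,3,1], [1,3,2], [3,3,3], [3,1,2], [4,3,2], [2,3,1]]"])
   (simp_all add: port_edges_def doubleton_eq_iff)

lemma ported_6_3_3: "ported 6 3 3"
  by (rule portedI[of
   "[[1,1,1], [1,2,3], [3,3,3], [1,3,2], [2,1,2], [4,1,3], [3,1,1], [5,2,1], [3,3,1], [5,3,2],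
    [3,2,2], [5,2,3], [3,1,3], [2,3,3], [1,3,1], [3,3,2], [5,2,2], [3,2,3], [5,3,3], [4,3,1],
    [6,2,1], [6,1,3], [5,1,1], [6,3,1], [4,2,1], [2,2,2], [4,2,3], [6,3,3], [4,3,2], [6,2,2],
    [4,1,2], [6,1,1], [5,1,3], [3,1,2], [1,2,2], [3,2,1], [5,3,1], [5,1,2], [6,3,2], [4,3,3],
    [6,2,3], [4,2,2], [6,1,2], [4,1,1], [2,2,1], [2,1,3], [1,3,3], [1,1,2], [2,3,2], [2,1,1],
    [1,1,3], [1,2,1], [2,2,3], [2,3,1]]"])
   (simp_all add: port_edges_def doubleton_eq_iff)

lemmas ported_base =
  ported_2_3_4 ported_2_3_5 ported_2_3_6 ported_2_3_7 ported_2_4_4 ported_2_4_5 ported_2_4_6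
  ported_2_4_7 ported_2_5_4 ported_2_5_5 ported_2_5_6 ported_2_5_7 ported_4_3_3 ported_6_3_3

section \<open>All required sizes in dimension three\<close>

text \<open>Slabs of length 4 are removed along axis 2 until \<open>b\<close> lies in 4, ..., 7, and
  slabs of length 3 along axis 1 until \<open>a\<close> lies in 3, 4, 5; the explicit tours cover
  what is left.\<close>

lemma ported_2:
  assumes "a \<ge> 3" "b \<ge> 4"
  shows "ported 2 a b"
proof -
  have narrow: "ported 2 a b" if a: "a \<in> {3, 4, 5}" and b: "b \<ge> 4" for a b
    using b
  proof (induction b rule: less_induct)
    case (less b)
    show ?case
    proof (cases "b \<ge> 8")
      case True
      then have "ported 2 a (b - 4)" using less.IH by simp
      moreover have "ported 2 a 4" using a ported_base by auto
      ultimately have "ported 2 a (b - 4 + 4)" by (rule ported_glue_2)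
      with True show ?thesis by simp
    next
      case False
      with less.prems have "b \<in> {4, 5, 6, 7}" by auto
      with a ported_base show ?thesis by auto
    qed
  qed
  show ?thesis using assms(1)
  proof (induction a rule: less_induct)
    case (less a)
    show ?case
    proof (cases "a \<ge> 6")
      case True
      then have "ported 2 (a - 3) b" using less.IH by simp
      moreover have "ported 2 3 b" using narrow assms(2) by simp
      ultimately have "ported 2 (a - 3 + 3) b" by (rule ported_glue_1)
      with True show ?thesis by simp
    next
      case False
      with less.prems have "a \<in> {3, 4, 5}" by auto
      with narrow assms(2) show ?thesis by simp
    qed
  qed
qed

text \<open>Copies of the board with first side 2 are glued along axis 0.\<close>

lemma ported_even:
  assumes "even k" "k \<ge> 2" "a \<ge> 3" "b \<ge> 4"
  shows "ported k a b"
  using assms(1,2)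
proof (induction k rule: less_induct)
  case (less k)
  show ?case
  proof (cases "k = 2")
    case True
    with ported_2 assms(3,4) show ?thesis by simp
  next
    case False
    with less.prems have k: "k \<ge> 4" "even (k - 2)" by (auto elim!: evenE)
    then have "ported (k - 2 + 2) a b"
      using less.IH[of "k - 2"] ported_2[OF assms(3,4)] by (intro ported_glue_0) auto
    moreover have "k - 2 + 2 = k" using k(1) by simp
    ultimately show ?thesis by (simp only:)
  qed
qed

text \<open>The board with sides 2, 3, 3 has no closed tour, so lengths grow in steps of 4 from the
  two base lengths 4 and 6.\<close>

lemma ported_even_3_3:
  assumes "even k" "k \<ge> 4"
  shows "ported k 3 3"
  using assms
proof (induction k rule: less_induct)
  case (less k)
  show ?case
  proof (cases "k \<ge> 8")
    case True
    with less have "ported (k - 4 + 4) 3 3"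
      using less.IH[of "k - 4"] ported_base by (intro ported_glue_0) auto
    moreover have "k - 4 + 4 = k" using True by simp
    ultimately show ?thesis by (simp only:)
  next
    case False
    with less.prems have "k = 4 \<or> k = 6" by presburger
    with ported_base show ?thesis by auto
  qed
qed

section \<open>Existence\<close>

lemma stackable_append:
  assumes "stackable ns" "\<forall>n\<in>set ms. n \<ge> 1"
  shows "stackable (ms @ ns)"
  using assms(2) by (induction ms) (simp_all add: assms(1) stackable_Cons)

text \<open>Permuting coordinates only relocates the two nonzero entries of the difference. Entry
  \<open>l\<close> of \<open>permute_list p c\<close> is \<open>c ! p l\<close>, so positions
  \<open>i\<close> and \<open>j\<close> move to their preimages under \<open>p\<close>.\<close>

lemma knight_adj_permute_list:
  assumes p: "p permutes {..<length a}" and "knight_adj a b"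
  shows "knight_adj (permute_list p a) (permute_list p b)"
proof -
  define c where "c = map2 (-) a b"
  have len: "length a = length b" and c: "knight_move c" "length c = length a"
    using assms(2) by (auto simp: knight_adj_def c_def)
  have eq: "map2 (-) (permute_list p a) (permute_list p b) = permute_list p c"
    unfolding c_def using p len
    by (simp add: permute_list_zip[symmetric] permute_list_map)
  obtain i j where ij: "i < length c" "j < length c" "i \<noteq> j" "\<bar>c ! i\<bar> = 1" "\<bar>c ! j\<bar> = 2"
    "\<forall>l<length c. l \<noteq> i \<and> l \<noteq> j \<longrightarrow> c ! l = 0"
    using c(1) unfolding knight_move_def by blast
  have q: "inv p l < length c" "p (inv p l) = l" if "l < length c" for l
    using that c(2) permutes_in_image[OF permutes_inv[OF p]] permutes_inverses(1)[OF p] by auto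
  have nth: "permute_list p c ! l = c ! p l" if "l < length c" for l
    using that p c(2) by (simp add: permute_list_nth)
  have "p l < length c" if "l < length c" for l
    using that c(2) permutes_in_image[OF p] by auto
  then have "permute_list p c ! l = 0" if "l < length c" "l \<noteq> inv p i" "l \<noteq> inv p j" for l
    using that nth ij(6) permutes_inverses(2)[OF p] by metis
  moreover have "inv p i \<noteq> inv p j" using q(2) ij(1-3) by metis
  moreover have "\<bar>permute_list p c ! inv p i\<bar> = 1" "\<bar>permute_list p c ! inv p j\<bar> = 2"
    using nth q ij by simp_all
  ultimately have "knight_move (permute_list p c)"
    unfolding knight_move_def length_permute_list using q(1)[OF ij(1)] q(1)[OF ij(2)] by blast
  with eq len show ?thesis by (simp add: knight_adj_def)
qed

text \<open>Stacking produces the sides in an order dictated by the construction, with an even side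
  at the head of the last three; this lemma restores the sorted order.\<close>

lemma has_closed_knight_tour_mset:
  assumes "has_closed_knight_tour ms" "mset ms = mset ns"
  shows "has_closed_knight_tour ns"
proof -
  obtain p where p: "p permutes {..<length ms}" "permute_list p ms = ns"
    using mset_eq_permutation[OF assms(2)[symmetric]] by blast
  let ?f = "permute_list p"
  have len: "length ns = length ms" using p(2) by auto
  obtain vs where vs: "distinct vs" "set vs = chessboard ms" "length vs \<ge> 3"
    "\<forall>i < length vs. knight_adj (vs ! i) (vs ! ((i + 1) mod length vs))"
    using assms(1) unfolding has_closed_knight_tour_def closed_knight_tour_def by blast
  have board: "length q = length ms" if "q \<in> chessboard ms" for q
    using that by (simp add: chessboard_def)
  have inj: "inj_on ?f (chessboard ms)"
  proof (rule inj_on_inverseI)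
    fix q assume q: "q \<in> chessboard ms"
    have "permute_list (p \<circ> inv p) q = permute_list (inv p) (?f q)"
      using permutes_inv[OF p(1)] board[OF q] by (intro permute_list_compose) simp
    then show "permute_list (inv p) (?f q) = q"
      using permutes_inv_o(1)[OF p(1)] by simp
  qed
  have "?f ` chessboard ms \<subseteq> chessboard ns"
  proof
    fix r assume "r \<in> ?f ` chessboard ms"
    then obtain q where q: "q \<in> chessboard ms" "r = ?f q" by blast
    have "1 \<le> q ! p i \<and> q ! p i \<le> int (ms ! p i)" if "i < length ms" for i
      using q(1) that permutes_in_image[OF p(1), of i] by (simp add: chessboard_def)
    then show "r \<in> chessboard ns"
      using q(2) board[OF q(1)] p by (auto simp: chessboard_def permute_list_nth)
  qed
  \<comment> \<open>The volume depends only on the multiset of sides, so inclusion and injectivity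
    make the image the whole board.\<close>
  moreover have "card (?f ` chessboard ms) = card (chessboard ns)"
    using inj assms(2) by (simp add: card_image finite_card_chessboard flip: prod_mset_prod_list)
  ultimately have "set (map ?f vs) = chessboard ns"
    using card_subset_eq finite_card_chessboard vs(2) by (metis list.set_map)
  moreover have "distinct (map ?f vs)" using vs(1,2) inj by (simp add: distinct_map)
  moreover have "knight_adj (map ?f vs ! i) (map ?f vs ! ((i + 1) mod length (map ?f vs)))"
    if "i < length (map ?f vs)" for i
  proof -
    have i: "i < length vs" "(i + 1) mod length vs < length vs"
      using that by (simp_all only: length_map) (intro mod_less_divisor, linarith)
    moreover have "length (vs ! i) = length ms" using i(1) board vs(2) by (metis nth_mem)
    ultimately show ?thesis using vs(4) p(1) by (simp add: knight_adj_permute_list)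
  qed
  ultimately show ?thesis
    using vs(3) unfolding has_closed_knight_tour_def closed_knight_tour_def
    by (intro exI[of _ "map ?f vs"]) simp
qed

text \<open>The three sides \<open>k\<close>, \<open>a\<close>, \<open>b\<close> carry the base
  tour, and each side in \<open>ms\<close> is added by stacking.\<close>

lemma tour_of_ported:
  assumes "ported k a b" "\<forall>n\<in>set ms. n \<ge> 1" "mset ns = mset ms + {#k, a, b#}"
  shows "has_closed_knight_tour ns"
proof -
  have "stackable (ms @ [k, a, b])"
    using assms by (intro stackable_append ported_imp_stackable)
  then obtain E where "knight_cycle (ms @ [k, a, b]) E" unfolding stackable_def by blast
  then have "has_closed_knight_tour (ms @ [k, a, b])" by (rule knight_cycle_imp_tour)
  then show ?thesis by (rule has_closed_knight_tour_mset) (simp add: assms(3))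
qed

lemma tour_exists:
  assumes "sorted (ns @ [a, b])" "ns \<noteq> []" "\<forall>n\<in>set ns. n \<ge> 2"
    and "\<exists>n\<in>set (ns @ [a, b]). even n" "a \<ge> 3" "b \<ge> 4"
  shows "has_closed_knight_tour (ns @ [a, b])"
proof (cases "\<exists>k\<in>set ns. even k")
  case True
  then obtain k where k: "k \<in> set ns" "even k" by blast
  then have "ported k a b" using assms by (intro ported_even) auto
  moreover have "\<forall>n\<in>set (remove1 k ns). n \<ge> 1"
    using assms(3) set_remove1_subset[of k ns] by fastforce
  ultimately show ?thesis by (rule tour_of_ported) (simp add: k(1))
next
  case False
  \<comment> \<open>With all sides in \<open>ns\<close> odd, the largest of them is an odd
    \<open>c \<ge> 3\<close>; it joins \<open>a\<close> and \<open>b\<close>, one of which must be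
    even.\<close>
  define ms c where "ms = butlast ns" and "c = last ns"
  have ns: "ns = ms @ [c]" using assms(2) by (simp add: ms_def c_def)
  have c: "odd c" "c \<ge> 2" "c \<le> a" "a \<le> b"
    using False assms(1,3) by (auto simp: ns sorted_append)
  then have c3: "c \<ge> 3" by presburger
  have ms: "\<forall>n\<in>set ms. n \<ge> 1" using assms(3) by (auto simp: ns)
  show ?thesis
  proof (cases "even b")
    case True
    \<comment> \<open>The sides \<open>c\<close> and \<open>a\<close> accompany the even side
      \<open>b\<close>; if \<open>a\<close> is below 4, both equal 3 and the separate family with
      two sides 3 applies.\<close>
    have "ported b c a"
    proof (cases "a \<ge> 4")
      case True
      with \<open>even b\<close> c3 assms(6) show ?thesis by (intro ported_even) auto
    next
      case False
      with c(3) c3 have "c = 3" "a = 3" by auto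
      with \<open>even b\<close> assms(6) show ?thesis by (simp add: ported_even_3_3)
    qed
    then show ?thesis using ms by (rule tour_of_ported) (simp add: ns)
  next
    case odd_b: False
    with False assms(4) have "even a" by auto
    then have "ported a c b" using c3 assms(5,6) by (intro ported_even) auto
    then show ?thesis using ms by (rule tour_of_ported) (simp add: ns)
  qed
qed

section \<open>Obstructions\<close>

lemma even_jump: "jump m a b \<Longrightarrow> even (sum_list a + sum_list b + m)"
proof (induction m a b rule: jump.induct)
  case (1 m x a y b)
  show ?case
  proof (cases "x = y")
    case True
    with 1 have "even (sum_list a + sum_list b + m)" by simp
    moreover have "sum_list (x # a) + sum_list (y # b) + m = 2 * x + (sum_list a + sum_list b + m)"
      using True by simp
    ultimately show ?thesis by simp
  next
    case False
    with 1 have "a = b" and "m = x - y \<or> m = y - x" by (auto simp: abs_if split: if_splits)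
    then show ?thesis by auto
  qed
qed simp_all

text \<open>The coordinates change by 1 and by 2 up to sign, so the coordinate sum changes by an odd
  number: each move flips the chessboard colour.\<close>

lemma odd_knight_adj: "knight_adj a b \<Longrightarrow> odd (sum_list a + sum_list b)"
proof (induction a arbitrary: b)
  case (Cons x a)
  then obtain y c where b: "b = y # c" by (cases b) auto
  show ?case
  proof (cases "x = y")
    case True
    with Cons b have "odd (sum_list a + sum_list c)" by simp
    with True b show ?thesis by simp
  next
    case False
    \<comment> \<open>Here \<open>m\<close> is the part of the move left to the tail, and the first
      coordinate changes by the other part \<open>3 - m\<close>.\<close>
    with Cons.prems b obtain m where "m = 1 \<or> m = 2" "jump m a c" "\<bar>x - y\<bar> = 3 - m"
      by fastforce
    then have "x = y + (3 - m) \<or> y = x + (3 - m)" by linarith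
    then have "odd (x + y + m)" by auto
    moreover have "even (sum_list a + sum_list c + m)" using \<open>jump m a c\<close> by (rule even_jump)
    ultimately show ?thesis by (simp add: b) argo
  qed
qed simp

text \<open>Following the tour from its first cell reaches every cell, so a quantity preserved by
  each move is constant on the board.\<close>

lemma tour_invariant:
  assumes "closed_knight_tour ns vs" "p \<in> chessboard ns" "q \<in> chessboard ns"
    and "\<And>a b. a \<in> chessboard ns \<Longrightarrow> b \<in> chessboard ns \<Longrightarrow> knight_adj a b \<Longrightarrow> P a = P b"
  shows "P p = P q"
proof -
  have vs: "set vs = chessboard ns" "\<forall>i < length vs. knight_adj (vs ! i) (vs ! ((i + 1) mod length vs))"
    using assms(1) by (auto simp: closed_knight_tour_def)
  have const: "P (vs ! i) = P (vs ! 0)" if "i < length vs" for i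
    using that
  proof (induction i)
    case (Suc i)
    then have "knight_adj (vs ! i) (vs ! Suc i)" using vs(2)[rule_format, of i] by simp
    then have "P (vs ! i) = P (vs ! Suc i)"
      using assms(4) vs(1) Suc.prems by (metis Suc_lessD nth_mem)
    with Suc show ?case by simp
  qed simp
  show ?thesis using const assms(2,3) unfolding vs(1)[symmetric] by (metis in_set_conv_nth)
qed

lemma no_tour_all_odd:
  assumes "\<forall>n\<in>set ns. odd n"
  shows "\<not> has_closed_knight_tour ns"
proof
  assume "has_closed_knight_tour ns"
  then obtain vs where vs: "distinct vs" "set vs = chessboard ns" "length vs \<ge> 3"
    "\<forall>i < length vs. knight_adj (vs ! i) (vs ! ((i + 1) mod length vs))"
    unfolding has_closed_knight_tour_def closed_knight_tour_def by blast
  have alt: "even (sum_list (vs ! i) + sum_list (vs ! 0) + int i)" if "i < length vs" for i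
    using that
  proof (induction i)
    case (Suc i)
    then have "odd (sum_list (vs ! i) + sum_list (vs ! Suc i))"
      using vs(4)[rule_format, of i] odd_knight_adj by simp
    with Suc show ?case by simp argo
  qed simp
  obtain m where m: "length vs = Suc m" using vs(3) by (cases "length vs") auto
  \<comment> \<open>The closing move from the last index \<open>m\<close> back to 0 also flips the
    colour. This forces \<open>m\<close> to be odd and the length \<open>Suc m\<close> to be
    even.\<close>
  then have "odd (sum_list (vs ! m) + sum_list (vs ! 0))"
    using vs(4)[rule_format, of m] odd_knight_adj by simp
  with alt[of m] m have "even (length vs)" by simp
  moreover have "length vs = prod_list ns"
    using vs(1,2) finite_card_chessboard distinct_card by metis
  moreover have "odd (prod_list ns)" using assms by (induction ns) auto
  ultimately show False by simp
qed

lemma knight_adjE: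
  assumes "knight_adj a b"
  obtains j where "j < length a" "\<bar>a ! j - b ! j\<bar> = 2"
proof -
  have len: "length a = length b" using assms by (simp add: knight_adj_def)
  obtain j where "j < length (map2 (-) a b)" "\<bar>map2 (-) a b ! j\<bar> = 2"
    using assms unfolding knight_adj_def knight_move_def by blast
  then show thesis using len by (intro that[of j]) simp_all
qed

text \<open>A coordinate confined to 1 and 2 cannot change by 2, so every move spends its 2 on the
  last coordinate, whose parity is therefore invariant. The cells \<open>?p\<close> and
  \<open>?q\<close> have opposite parities there.\<close>

lemma no_tour_thin:
  assumes "\<forall>n\<in>set (ns @ [b]). n \<ge> 2" "\<forall>n\<in>set ns. n \<le> 2"
  shows "\<not> has_closed_knight_tour (ns @ [b])"
proof
  assume "has_closed_knight_tour (ns @ [b])"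
  then obtain vs where vs: "closed_knight_tour (ns @ [b]) vs"
    by (auto simp: has_closed_knight_tour_def)
  let ?k = "length ns"
  let ?p = "replicate ?k 1 @ [1 :: int]" and ?q = "replicate ?k 1 @ [2 :: int]"
  have "even (?p ! ?k) = even (?q ! ?k)"
  proof (rule tour_invariant[OF vs, where P = "\<lambda>x. even (x ! ?k)"])
    show "?p \<in> chessboard (ns @ [b])" "?q \<in> chessboard (ns @ [b])"
      using assms(1) by (fastforce simp: chessboard_def nth_append dest: nth_mem)+
  next
    fix x y assume xy: "x \<in> chessboard (ns @ [b])" "y \<in> chessboard (ns @ [b])" "knight_adj x y"
    obtain j where j: "j < length x" "\<bar>x ! j - y ! j\<bar> = 2"
      using knight_adjE[OF xy(3)] by blast
    have "j = ?k"
    proof (rule ccontr)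
      assume "j \<noteq> ?k"
      then have "j < ?k" using j(1) xy(1) by (simp add: chessboard_def)
      then have "(ns @ [b]) ! j \<le> 2" using assms(2) by (simp add: nth_append)
      moreover have "1 \<le> z ! j" "z ! j \<le> int ((ns @ [b]) ! j)" if "z \<in> chessboard (ns @ [b])" for z
        using that \<open>j < ?k\<close> unfolding chessboard_def by simp_all
      note this[OF xy(1)] this[OF xy(2)]
      ultimately show False using j(2) by linarith
    qed
    with j(2) have "x ! ?k = y ! ?k + 2 \<or> y ! ?k = x ! ?k + 2" by (simp only:) linarith
    then show "even (x ! ?k) = even (y ! ?k)" by auto
  qed
  then show False by (simp add: nth_append)
qed

text \<open>From the cell \<open>?c\<close> with all coordinates 2, a change by 2 leads to 0 or 4,
  outside every side of length at most 3.\<close>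

lemma no_tour_2_3:
  assumes "\<forall>n\<in>set ns. n \<ge> 2 \<and> n \<le> 3"
  shows "\<not> has_closed_knight_tour ns"
proof
  assume "has_closed_knight_tour ns"
  then obtain vs where vs: "set vs = chessboard ns"
    "\<forall>i < length vs. knight_adj (vs ! i) (vs ! ((i + 1) mod length vs))"
    unfolding has_closed_knight_tour_def closed_knight_tour_def by blast
  let ?c = "replicate (length ns) 2 :: int list"
  have ns: "2 \<le> ns ! i" "ns ! i \<le> 3" if "i < length ns" for i
    using assms that by auto
  have "?c \<in> chessboard ns" using ns by (force simp: chessboard_def)
  then obtain i where i: "i < length vs" "vs ! i = ?c" using vs(1) by (metis in_set_conv_nth)
  define q where "q = vs ! ((i + 1) mod length vs)"
  have "q \<in> chessboard ns" unfolding q_def vs(1)[symmetric] using i(1)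
    by (intro nth_mem mod_less_divisor) linarith
  have "knight_adj ?c q" using vs(2) i unfolding q_def by metis
  then obtain j where j: "j < length ns" "\<bar>2 - q ! j\<bar> = 2"
    by (rule knight_adjE) simp
  have "1 \<le> q ! j" "q ! j \<le> int (ns ! j)"
    using \<open>q \<in> chessboard ns\<close> j(1) by (simp_all add: chessboard_def)
  with j ns(2)[of j] show False by linarith
qed

theorem theorem1p3:
  fixes ns :: "nat list"
  assumes "length ns \<ge> 3"
    and "ns ! 0 \<ge> 2"
    and "sorted ns"
  shows "\<not> has_closed_knight_tour ns \<longleftrightarrow>
           ((\<forall>i < length ns. odd (ns ! i)) \<or>
            ns ! (length ns - 2) = 2 \<or>
            ns ! (length ns - 1) = 3)"
proof -
  obtain xs b where xs: "ns = xs @ [b]"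
    using assms(1) by (cases ns rule: rev_cases) auto
  obtain ms a where ms: "xs = ms @ [a]"
    using assms(1) xs by (cases xs rule: rev_cases) auto
  have ns: "ns = ms @ [a, b]" "ms \<noteq> []" using assms(1) by (auto simp: xs ms)
  have ge: "\<forall>n\<in>set ns. n \<ge> 2"
    using assms by (metis in_set_conv_nth le_trans sorted_nth_mono zero_le)
  have le: "\<forall>n\<in>set ms. n \<le> a" "a \<le> b" using assms(3) by (auto simp: ns sorted_append)
  have ab: "ns ! (length ns - 2) = a" "ns ! (length ns - 1) = b"
    by (simp_all add: ns(1) nth_append)
  have odd: "(\<forall>i < length ns. odd (ns ! i)) \<longleftrightarrow> (\<forall>n\<in>set ns. odd n)"
    by (metis in_set_conv_nth)
  show ?thesis
    unfolding ab odd
  proof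
    assume "(\<forall>n\<in>set ns. odd n) \<or> a = 2 \<or> b = 3"
    then consider "\<forall>n\<in>set ns. odd n" | "a = 2" | "b = 3" by blast
    then show "\<not> has_closed_knight_tour ns"
    proof cases
      case 1
      then show ?thesis by (rule no_tour_all_odd)
    next
      case 2
      then show ?thesis using no_tour_thin[of "ms @ [a]" b] ge le by (simp add: ns(1))
    next
      case 3
      then show ?thesis using ge le by (intro no_tour_2_3) (auto simp: ns(1) intro: order_trans)
    qed
  next
    assume no: "\<not> has_closed_knight_tour ns"
    show "(\<forall>n\<in>set ns. odd n) \<or> a = 2 \<or> b = 3"
    proof (rule ccontr)
      assume "\<not> ((\<forall>n\<in>set ns. odd n) \<or> a = 2 \<or> b = 3)"
      then have "\<exists>n\<in>set ns. even n" "a \<noteq> 2" "b \<noteq> 3" by blast+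
      \<comment> \<open>From \<open>a \<ge> 2\<close> and \<open>a \<noteq> 2\<close> follows
        \<open>a \<ge> 3\<close>; then \<open>b \<ge> a\<close> together with
        \<open>b \<noteq> 3\<close> gives \<open>b \<ge> 4\<close>.\<close>
      moreover from this have "a \<ge> 3" "b \<ge> 4" using ge le(2) by (auto simp: ns(1))
      ultimately have "has_closed_knight_tour (ms @ [a, b])"
        using assms(3) ge ns by (intro tour_exists) auto
      with no ns(1) show False by simp
    qed
  qed
qed

end
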